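(* Let $0\le\gamma<1$, $q\in(0,1)$, $k\ge 0$, $\alpha>0$, $\beta>-1$. If a function $f(z)=z+\sum_{n=2}^\infty a_nz^n$, analytic in the open unit disc $\mathbb{D}$, satisfies the inequality $$\sum_{n=2}^\infty \big([n]_q(k+1)-(k+\gamma)\big)\frac{\Gamma_q(\beta+n)}{\Gamma_q(\alpha+\beta+n)}\frac{\Gamma_q(\alpha+\beta+1)}{\Gamma_q(\beta+1)}\,|a_n|\le 1-\gamma,$$ then $f$ belongs to the class $k\text{-}\mathcal{JUST}(q;\alpha,\beta,\gamma)$. The result is sharp.
   Context: $\mathcal{A}$ is the class of functions $f(z)=z+\sum_{n\ge2}a_nz^n$ analytic in $\mathbb{D}=\{z\in\mathbb{C}:|z|<1\}$. For $q\in(0,1)$, $[x]_q=\frac{1-q^x}{1-q}$, and $\Gamma_q$ is the $q$-gamma function, satisfying $\Gamma_q(x+1)=[x]_q\Gamma_q(x)$; for $n\ge2$ put $$\psi_n:=\frac{\Gamma_q(\beta+n)}{\Gamma_q(\alpha+\beta+n)}\frac{\Gamma_q(\alpha+\beta+1)}{\Gamma_q(\beta+1)}=\prod_{j=1}^{n-1}\frac{[\beta+j]_q}{[\alpha+\beta+j]_q}.$$ The $q$-derivative is $(D_qg)(z)=\frac{g(z)-g(qz)}{(1-q)z}$ for $z\ne0$ and $(D_qg)(0)=g'(0)$. For $\alpha>0$, $\beta>-1$ the generalized $q$-integral operator $\chi^{\alpha}_{\beta,q}:\mathcal{A}\to\mathcal{A}$ is $\chi^{\alpha}_{\beta,q}f(z)=z+\sum_{n=2}^\infty\psi_na_nz^n$.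 A function $f\in\mathcal{A}$ is in $k\text{-}\mathcal{JUST}(q;\alpha,\beta,\gamma)$ if and only if, with $p(z)=\frac{zD_q(\chi^{\alpha}_{\beta,q}f)(z)}{\chi^{\alpha}_{\beta,q}f(z)}$ (with $p(0)=1$), one has $\operatorname{Re}p(z)>k|p(z)-1|+\gamma$ for all $z\in\mathbb{D}$. Sharpness is understood in the sense that equality in the coefficient inequality is attained by members of the class, namely by the functions $f_n(z)=z-\frac{1-\gamma}{([n]_q(k+1)-(k+\gamma))\,\psi_n}z^n$. *)

theory Defs
  imports "HOL-Complex_Analysis.Complex_Analysis"
begin

definition q_number :: "real \<Rightarrow> real \<Rightarrow> real" where
  "q_number q x = (1 - q powr x) / (1 - q)"

definition qpoch_inf :: "real \<Rightarrow> real \<Rightarrow> real" where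
  "qpoch_inf a q = (\<Prod>n. 1 - a * q ^ n)"

text \<open>The usual (Jackson) q-gamma function for \<open>0 < q < 1\<close>. It is meaningful when \<open>x\<close> is not a
  non-positive integer; below, all arguments are positive.\<close>

definition q_Gamma :: "real \<Rightarrow> real \<Rightarrow> real" where
  "q_Gamma q x = (1 - q) powr (1 - x) * qpoch_inf q q / qpoch_inf (q powr x) q"

definition psi :: "real \<Rightarrow> real \<Rightarrow> real \<Rightarrow> nat \<Rightarrow> real" where
  "psi q \<alpha> \<beta> n =
     q_Gamma q (\<beta> + real n) / q_Gamma q (\<alpha> + \<beta> + real n) *
     (q_Gamma q (\<alpha> + \<beta> + 1) / q_Gamma q (\<beta> + 1))"

abbreviation taylor_coeff :: "(complex \<Rightarrow> complex) \<Rightarrow> nat \<Rightarrow> complex" where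
  "taylor_coeff f n \<equiv> fps_nth (fps_expansion f 0) n"

text \<open>Functions on the disc are represented by total functions on \<open>complex\<close>, whose values
  outside the disc are irrelevant. Series over \<open>n \<ge> 2\<close> are indexed by \<open>n + 2\<close> with \<open>n \<ge> 0\<close>.\<close>

definition class_A :: "(complex \<Rightarrow> complex) set" where
  "class_A = {f. f holomorphic_on ball 0 1 \<and>
     (\<forall>z\<in>ball 0 1. (\<lambda>n. taylor_coeff f (n + 2) * z ^ (n + 2)) sums (f z - z))}"

definition q_deriv :: "real \<Rightarrow> (complex \<Rightarrow> complex) \<Rightarrow> complex \<Rightarrow> complex" where
  "q_deriv q g z =
     (if z = 0 then deriv g 0
      else (g z - g (of_real q * z)) / ((1 - of_real q) * z))"

definition q_integral_op ::
    "real \<Rightarrow> real \<Rightarrow> real \<Rightarrow> (complex \<Rightarrow> complex) \<Rightarrow> complex \<Rightarrow> complex" where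
  "q_integral_op q \<alpha> \<beta> f z =
     z + (\<Sum>n. of_real (psi q \<alpha> \<beta> (n + 2)) * taylor_coeff f (n + 2) * z ^ (n + 2))"

definition JUST_quotient ::
    "real \<Rightarrow> real \<Rightarrow> real \<Rightarrow> (complex \<Rightarrow> complex) \<Rightarrow> complex \<Rightarrow> complex" where
  "JUST_quotient q \<alpha> \<beta> f z =
     (if z = 0 then 1
      else z * q_deriv q (q_integral_op q \<alpha> \<beta> f) z / q_integral_op q \<alpha> \<beta> f z)"

text \<open>The non-vanishing condition makes explicit that the quotient is defined on the whole disc,
  instead of relying on division by zero yielding zero.\<close>

definition JUST ::
    "real \<Rightarrow> real \<Rightarrow> real \<Rightarrow> real \<Rightarrow> real \<Rightarrow> (complex \<Rightarrow> complex) set" where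
  "JUST k q \<alpha> \<beta> \<gamma> = {f \<in> class_A.
     (\<forall>z\<in>ball 0 1. z \<noteq> 0 \<longrightarrow> q_integral_op q \<alpha> \<beta> f z \<noteq> 0) \<and>
     (\<forall>z\<in>ball 0 1. Re (JUST_quotient q \<alpha> \<beta> f z) >
        k * cmod (JUST_quotient q \<alpha> \<beta> f z - 1) + \<gamma>)}"

definition JUST_weight :: "real \<Rightarrow> real \<Rightarrow> real \<Rightarrow> real \<Rightarrow> real \<Rightarrow> nat \<Rightarrow> real" where
  "JUST_weight k q \<alpha> \<beta> \<gamma> n =
     (q_number q (real n) * (k + 1) - (k + \<gamma>)) * psi q \<alpha> \<beta> n"

definition JUST_extremal ::
    "real \<Rightarrow> real \<Rightarrow> real \<Rightarrow> real \<Rightarrow> real \<Rightarrow> nat \<Rightarrow> complex \<Rightarrow> complex" where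
  "JUST_extremal k q \<alpha> \<beta> \<gamma> n z =
     z - of_real ((1 - \<gamma>) / JUST_weight k q \<alpha> \<beta> \<gamma> n) * z ^ n"

end

theory Submission
  imports Defs
begin

text \<open>
  Write \<open>g\<close> for the image of \<open>f\<close> under the \<open>q\<close>-integral operator and \<open>c\<^sub>n = \<psi>\<^sub>n a\<^sub>n\<close> for its
  coefficients. The \<open>q\<close>-derivative multiplies the \<open>n\<close>-th coefficient by \<open>[n]\<^sub>q\<close>, so
  \<open>p - 1 = (\<Sum>n\<ge>2. ([n]\<^sub>q - 1) c\<^sub>n z\<^sup>n) / g\<close> for the quotient \<open>p\<close>. Since \<open>Re p \<ge> 1 - \<bar>p - 1\<bar>\<close>, it is
  enough that \<open>(k + 1) \<bar>p - 1\<bar> < 1 - \<gamma>\<close>.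

  The weight in the hypothesis is designed for this: as
  \<open>[n]\<^sub>q (k + 1) - (k + \<gamma>) = (k + 1) ([n]\<^sub>q - 1) + (1 - \<gamma>)\<close>, the hypothesis reads
  \<open>(k + 1) A + (1 - \<gamma>) C \<le> 1 - \<gamma>\<close> with \<open>A = \<Sum>([n]\<^sub>q - 1) \<bar>c\<^sub>n\<bar>\<close> and \<open>C = \<Sum>\<bar>c\<^sub>n\<bar>\<close>. On
  \<open>\<bar>z\<bar> = r < 1\<close> the numerator above has modulus at most \<open>r\<^sup>2 A\<close> and the denominator at least
  \<open>r - r\<^sup>2 C > 0\<close>, and the required strict inequality comes from \<open>r < 1\<close>
  (lemma \<open>quotient_in_conic_domain\<close>). Reading the hypothesis in this way needs
  \<open>\<psi>\<^sub>n \<bar>a\<^sub>n\<bar> = \<bar>c\<^sub>n\<bar>\<close>, that is \<open>\<psi>\<^sub>n \<ge> 0\<close>; this is positivity of the \<open>q\<close>-gamma function on the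
  positive axis (lemma \<open>q_Gamma_pos\<close>). Together with \<open>[n]\<^sub>q \<ge> 1\<close> it makes the weighted series
  dominate those of \<open>A\<close> and \<open>C\<close>, so both are finite.

  For sharpness, the extremal function has a single coefficient beyond the linear one, namely the
  one for which the weighted sum equals \<open>1 - \<gamma>\<close>; hence it satisfies the criterion with equality,
  and the first half of the theorem puts it into the class.
\<close>

section \<open>Positivity of the weights\<close>

lemma qpoch_inf_pos:
  assumes "0 < q" "q < 1" "0 < a" "a < 1"
  shows "0 < qpoch_inf a q"
proof -
  have factor: "a * q ^ n < 1" for n
  proof -
    have "a * q ^ n \<le> a * 1"
      using assms by (intro mult_left_mono power_le_one) auto
    then show ?thesis using assms by linarith
  qed
  have "summable (\<lambda>n. \<bar>- (a * q ^ n)\<bar>)"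
    using assms by (auto simp: abs_mult intro!: summable_mult summable_geometric)
  then have "convergent_prod (\<lambda>n. 1 + - (a * q ^ n))"
  proof (rule summable_imp_convergent_prod_real)
    show "- (a * q ^ n) \<noteq> - 1" for n using factor[of n] by simp
  qed
  then have "convergent_prod (\<lambda>n. 1 - a * q ^ n)" by simp
  then show ?thesis
    unfolding qpoch_inf_def using factor by (intro less_0_prodinf) auto
qed

lemma q_Gamma_pos:
  assumes "0 < q" "q < 1" "0 < x"
  shows "0 < q_Gamma q x"
proof -
  have "q powr x < 1"
    using assms powr_less_mono'[of q 0 x] by simp
  then show ?thesis
    unfolding q_Gamma_def using assms
    by (intro divide_pos_pos mult_pos_pos qpoch_inf_pos) auto
qed

lemma psi_pos:
  assumes "0 < q" "q < 1" "0 < \<alpha>" "-1 < \<beta>" "1 \<le> n"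
  shows "0 < psi q \<alpha> \<beta> n"
proof -
  have "1 \<le> real n" using assms by simp
  with assms show ?thesis
    unfolding psi_def by (intro mult_pos_pos divide_pos_pos q_Gamma_pos; linarith)
qed

lemma q_number_ge_1:
  assumes "0 < q" "q < 1" "1 \<le> x"
  shows "1 \<le> q_number q x"
proof -
  have "q powr x \<le> q powr 1"
    using assms by (intro powr_mono') auto
  then show ?thesis
    using assms by (simp add: q_number_def)
qed

text \<open>The split separates the contribution of \<open>z D\<^sub>q g - g\<close>, with factor \<open>k + 1\<close>, from that of the
  denominator \<open>g\<close>, with factor \<open>1 - \<gamma>\<close>.\<close>

lemma JUST_weight_eq:
  "JUST_weight k q \<alpha> \<beta> \<gamma> n
     = (k + 1) * ((q_number q (real n) - 1) * psi q \<alpha> \<beta> n) + (1 - \<gamma>) * psi q \<alpha> \<beta> n"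
  by (simp add: JUST_weight_def algebra_simps)

lemma JUST_weight_pos:
  assumes "\<gamma> < 1" "0 < q" "q < 1" "0 \<le> k" "0 < \<alpha>" "-1 < \<beta>" "1 \<le> n"
  shows "0 < JUST_weight k q \<alpha> \<beta> \<gamma> n"
proof -
  have "0 < psi q \<alpha> \<beta> n" "1 \<le> q_number q (real n)"
    using assms by (auto intro: psi_pos q_number_ge_1)
  then show ?thesis
    unfolding JUST_weight_eq using assms by (intro add_nonneg_pos) auto
qed

section \<open>Power series with absolutely summable coefficients\<close>

lemma
  fixes b :: "nat \<Rightarrow> complex"
  assumes "summable (\<lambda>n. norm (b n))" "norm z \<le> 1"
  shows summable_power_series_unit: "summable (\<lambda>n. b n * z ^ (n + 2))"
    and norm_power_series_le: "norm (\<Sum>n. b n * z ^ (n + 2)) \<le> (norm z)\<^sup>2 * (\<Sum>n. norm (b n))"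
proof -
  have term_le: "norm (b n * z ^ (n + 2)) \<le> (norm z)\<^sup>2 * norm (b n)" for n
  proof -
    have "norm (b n * z ^ (n + 2)) = norm z ^ n * ((norm z)\<^sup>2 * norm (b n))"
      by (simp add: norm_mult norm_power power_add power2_eq_square mult_ac)
    also have "\<dots> \<le> 1 * ((norm z)\<^sup>2 * norm (b n))"
      using assms(2) by (intro mult_right_mono power_le_one) auto
    finally show ?thesis by simp
  qed
  have majorant: "summable (\<lambda>n. (norm z)\<^sup>2 * norm (b n))"
    using assms(1) by (rule summable_mult)
  show "summable (\<lambda>n. b n * z ^ (n + 2))"
    using majorant term_le by (rule summable_comparison_test'[where N = 0])
  have "norm (\<Sum>n. b n * z ^ (n + 2)) \<le> (\<Sum>n. (norm z)\<^sup>2 * norm (b n))"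
    using term_le majorant by (rule norm_suminf_le)
  also have "\<dots> = (norm z)\<^sup>2 * (\<Sum>n. norm (b n))"
    using assms(1) by (rule suminf_mult)
  finally show "norm (\<Sum>n. b n * z ^ (n + 2)) \<le> (norm z)\<^sup>2 * (\<Sum>n. norm (b n))" .
qed

text \<open>The \<open>q\<close>-difference quotient of \<open>z\<^sup>n\<close> is \<open>[n]\<^sub>q z\<^sup>n\<^sup>-\<^sup>1\<close>. Splitting off \<open>1\<close> from \<open>[n]\<^sub>q\<close>
  expresses \<open>z D\<^sub>q g\<close> as a perturbation of \<open>g\<close> itself, which is the form needed to control
  the distance of the quotient from \<open>1\<close>.\<close>

lemma q_deriv_power_series:
  fixes c :: "nat \<Rightarrow> complex"
  assumes q: "0 < q" "q < 1" and z: "norm z < 1" "z \<noteq> 0"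
    and c: "summable (\<lambda>n. norm (c n))"
    and g: "\<And>w. g w = w + (\<Sum>n. c n * w ^ (n + 2))"
  shows "z * q_deriv q g z
           = g z + (\<Sum>n. of_real (q_number q (real (n + 2)) - 1) * c n * z ^ (n + 2))"
proof -
  have qz: "norm (of_real q * z) \<le> 1"
    using q z by (simp add: norm_mult mult_le_one)
  have sz: "summable (\<lambda>n. c n * z ^ (n + 2))"
    using c z by (intro summable_power_series_unit) auto
  have sqz: "summable (\<lambda>n. c n * (of_real q * z) ^ (n + 2))"
    using c qz by (rule summable_power_series_unit)
  have q1: "1 - complex_of_real q \<noteq> 0"
    using q by (metis eq_iff_diff_eq_0 less_irrefl of_real_1 of_real_eq_iff)
  have q_number: "complex_of_real (q_number q (real m))
      = (1 - of_real q ^ m) / (1 - of_real q)" for m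
    using q by (simp add: q_number_def powr_realpow)
  let ?d = "\<lambda>n. c n * z ^ (n + 2) - c n * (of_real q * z) ^ (n + 2)"
  have "z * q_deriv q g z = (g z - g (of_real q * z)) / (1 - of_real q)"
    using z by (simp add: q_deriv_def)
  also have "g z - g (of_real q * z) = (1 - of_real q) * z + (\<Sum>n. ?d n)"
    unfolding g using suminf_diff[OF sz sqz] by (simp add: algebra_simps)
  also have "((1 - of_real q) * z + (\<Sum>n. ?d n)) / (1 - of_real q)
      = z + (\<Sum>n. ?d n) / (1 - of_real q)"
    using q1 by (simp add: add_divide_distrib)
  also have "(\<Sum>n. ?d n) / (1 - of_real q) = (\<Sum>n. ?d n / (1 - of_real q))"
    using summable_diff[OF sz sqz] by (rule suminf_divide[symmetric])
  also have "(\<lambda>n. ?d n / (1 - of_real q))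
      = (\<lambda>n. of_real (q_number q (real (n + 2))) * c n * z ^ (n + 2))" (is "?L = ?R")
  proof
    show "?L n = ?R n" for n
      unfolding q_number power_mult_distrib using q1 by (simp add: field_simps)
  qed
  finally have total: "z * q_deriv q g z = z + suminf ?R" .
  have "summable (\<lambda>n. ?d n / (1 - of_real q))"
    using summable_diff[OF sz sqz] by (rule summable_divide)
  then have sR: "summable ?R"
    unfolding \<open>?L = ?R\<close> .
  have "suminf ?R - (\<Sum>n. c n * z ^ (n + 2))
      = (\<Sum>n. of_real (q_number q (real (n + 2)) - 1) * c n * z ^ (n + 2))"
    unfolding suminf_diff[OF sR sz] by (simp add: algebra_simps)
  then show ?thesis
    unfolding total g by (simp add: algebra_simps)
qed

section \<open>The coefficient criterion\<close>

text \<open>The inequality \<open>Re p > k \<bar>p - 1\<bar> + \<gamma>\<close> cuts out a domain bounded by a conic. It contains the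
  disc of radius \<open>(1 - \<gamma>) / (k + 1)\<close> around \<open>1\<close>, and the hypothesis on the two coefficient
  sums keeps the quotient \<open>(g + e) / g\<close> inside that disc.\<close>

lemma quotient_in_conic_domain:
  fixes z g e :: complex
  assumes z: "norm z < 1" "z \<noteq> 0" and "\<gamma> < 1" "0 \<le> k"
    and g: "norm (g - z) \<le> (norm z)\<^sup>2 * C"
    and e: "norm e \<le> (norm z)\<^sup>2 * A"
    and AC: "(k + 1) * A + (1 - \<gamma>) * C \<le> 1 - \<gamma>"
  shows "g \<noteq> 0" and "Re ((g + e) / g) > k * norm ((g + e) / g - 1) + \<gamma>"
proof -
  define r where "r = norm z"
  have r: "0 < r" "r < 1" using z by (auto simp: r_def)
  have "r \<le> norm g + norm (g - z)"
    unfolding r_def by (metis norm_triangle_sub norm_minus_commute)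
  then have g_lower: "r - r\<^sup>2 * C \<le> norm g"
    using g by (simp add: r_def)
  have "(k + 1) * norm e \<le> (k + 1) * (r\<^sup>2 * A)"
    using e \<open>0 \<le> k\<close> by (intro mult_left_mono) (auto simp: r_def)
  also have "\<dots> = r\<^sup>2 * ((k + 1) * A)" by simp
  also have "\<dots> \<le> r\<^sup>2 * ((1 - \<gamma>) * (1 - C))"
    using AC by (intro mult_left_mono) (auto simp: algebra_simps)
  also have "\<dots> = (1 - \<gamma>) * (r\<^sup>2 - r\<^sup>2 * C)" by (simp add: algebra_simps)
  \<comment> \<open>The only strict step: \<open>r\<^sup>2 < r\<close>. Equality in the coefficient hypothesis is therefore harmless.\<close>
  also have "\<dots> < (1 - \<gamma>) * (r - r\<^sup>2 * C)"
    using r \<open>\<gamma> < 1\<close> by (intro mult_strict_left_mono) (auto simp: power2_eq_square)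
  also have "\<dots> \<le> (1 - \<gamma>) * norm g"
    using g_lower \<open>\<gamma> < 1\<close> by (intro mult_left_mono) auto
  finally have bound: "(k + 1) * norm e < (1 - \<gamma>) * norm g" .
  have "0 \<le> (k + 1) * norm e"
    using \<open>0 \<le> k\<close> by simp
  with bound show "g \<noteq> 0" by auto
  then have quotient: "(g + e) / g = 1 + e / g"
    by (simp add: add_divide_distrib)
  have "(k + 1) * norm (e / g) < 1 - \<gamma>"
    using bound \<open>g \<noteq> 0\<close> by (simp add: norm_divide field_simps)
  moreover have "- norm (e / g) \<le> Re (e / g)"
    using abs_Re_le_cmod[of "e / g"] by linarith
  ultimately show "Re ((g + e) / g) > k * norm ((g + e) / g - 1) + \<gamma>"
    unfolding quotient by (simp add: algebra_simps)
qed

lemma coefficient_criterion: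
  assumes par: "\<gamma> < 1" "0 < q" "q < 1" "0 \<le> k" "0 < \<alpha>" "-1 < \<beta>"
    and f: "f \<in> class_A"
    and sum: "summable (\<lambda>n. JUST_weight k q \<alpha> \<beta> \<gamma> (n + 2) * cmod (taylor_coeff f (n + 2)))"
    and le: "(\<Sum>n. JUST_weight k q \<alpha> \<beta> \<gamma> (n + 2) * cmod (taylor_coeff f (n + 2))) \<le> 1 - \<gamma>"
  shows "f \<in> JUST k q \<alpha> \<beta> \<gamma>"
proof -
  define c where "c n = of_real (psi q \<alpha> \<beta> (n + 2)) * taylor_coeff f (n + 2)" for n
  define d where "d n = q_number q (real (n + 2)) - 1" for n
  define b where "b n = of_real (d n) * c n" for n
  let ?g = "q_integral_op q \<alpha> \<beta> f"
  have g: "?g w = w + (\<Sum>n. c n * w ^ (n + 2))" for w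
    by (simp add: q_integral_op_def c_def)
  have d: "0 \<le> d n" for n
    using q_number_ge_1[OF par(2,3), of "real (n + 2)"] by (simp add: d_def)
  have psi: "0 < psi q \<alpha> \<beta> (n + 2)" for n
    using par by (intro psi_pos) auto
  have weight: "JUST_weight k q \<alpha> \<beta> \<gamma> (n + 2) * cmod (taylor_coeff f (n + 2))
      = (k + 1) * norm (b n) + (1 - \<gamma>) * norm (c n)" for n
    unfolding JUST_weight_eq b_def c_def d_def[symmetric] norm_mult norm_of_real
    using d[of n] psi[of n] by (simp add: algebra_simps)
  note sum = sum[unfolded weight] and le = le[unfolded weight]
  have "summable (\<lambda>n. (1 - \<gamma>) * norm (c n))"
    using par by (intro summable_comparison_test'[OF sum, of 0]) auto
  from summable_mult[OF this, of "inverse (1 - \<gamma>)"] have sc: "summable (\<lambda>n. norm (c n))"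
    using par by (simp flip: mult.assoc)
  have "summable (\<lambda>n. (k + 1) * norm (b n))"
    using par by (intro summable_comparison_test'[OF sum, of 0]) auto
  from summable_mult[OF this, of "inverse (k + 1)"] have sb: "summable (\<lambda>n. norm (b n))"
    using par by (simp flip: mult.assoc)
  have AC: "(k + 1) * (\<Sum>n. norm (b n)) + (1 - \<gamma>) * (\<Sum>n. norm (c n)) \<le> 1 - \<gamma>"
    using le
    unfolding suminf_add[OF summable_mult[OF sb] summable_mult[OF sc], symmetric]
      suminf_mult[OF sb] suminf_mult[OF sc] .
  have key: "?g z \<noteq> 0 \<and> Re (JUST_quotient q \<alpha> \<beta> f z) >
        k * cmod (JUST_quotient q \<alpha> \<beta> f z - 1) + \<gamma>" if z: "norm z < 1" "z \<noteq> 0" for z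
  proof -
    let ?e = "\<Sum>n. b n * z ^ (n + 2)"
    have "z * q_deriv q ?g z = ?g z + ?e"
      unfolding b_def d_def using q_deriv_power_series[OF par(2,3) z sc g] .
    then have quotient: "JUST_quotient q \<alpha> \<beta> f z = (?g z + ?e) / ?g z"
      using z by (simp add: JUST_quotient_def)
    have g_bound: "norm (?g z - z) \<le> (norm z)\<^sup>2 * (\<Sum>n. norm (c n))"
      unfolding g using norm_power_series_le[OF sc, of z] z by simp
    have e_bound: "norm ?e \<le> (norm z)\<^sup>2 * (\<Sum>n. norm (b n))"
      using norm_power_series_le[OF sb, of z] z by simp
    show ?thesis
      unfolding quotient
      using quotient_in_conic_domain[OF z par(1,4) g_bound e_bound AC] by blast
  qed
  have "Re (JUST_quotient q \<alpha> \<beta> f z) > k * cmod (JUST_quotient q \<alpha> \<beta> f z - 1) + \<gamma>"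
    if "norm z < 1" for z
  proof (cases "z = 0")
    case True
    then show ?thesis using par by (simp add: JUST_quotient_def)
  next
    case False
    then show ?thesis using key that by blast
  qed
  then show ?thesis
    unfolding JUST_def using f key by auto
qed

section \<open>The extremal functions\<close>

lemma taylor_coeff_binomial:
  fixes a :: complex
  assumes "2 \<le> n"
  shows "taylor_coeff (\<lambda>z. z - a * z ^ n) (m + 2) = (if m = n - 2 then - a else 0)"
proof -
  have "(\<lambda>z. z - a * z ^ n) has_fps_expansion (fps_X - fps_const a * fps_X ^ n)"
    by (intro fps_expansion_intros)
  from fps_expansion_eqI[OF this] show ?thesis
    using assms by (auto simp: fps_X_power_nth fps_X_nth)
qed

lemma binomial_in_class_A:
  fixes a :: complex
  assumes "2 \<le> n"
  shows "(\<lambda>z. z - a * z ^ n) \<in> class_A"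
proof -
  have "(\<lambda>m. taylor_coeff (\<lambda>z. z - a * z ^ n) (m + 2) * z ^ (m + 2)) sums (z - a * z ^ n - z)" for z
  proof -
    have "(\<lambda>m. if m = n - 2 then - a * z ^ (m + 2) else 0) sums (- a * z ^ (n - 2 + 2))"
      by (rule sums_single)
    then show ?thesis
      unfolding taylor_coeff_binomial[OF assms] le_add_diff_inverse2[OF assms]
      by (simp add: if_distrib[of "\<lambda>x. x * _"] cong: if_cong)
  qed
  then show ?thesis
    unfolding class_A_def by (auto intro!: holomorphic_intros)
qed

lemma JUST_extremal_weighted_sum:
  assumes "\<gamma> < 1" "0 < JUST_weight k q \<alpha> \<beta> \<gamma> n" "2 \<le> n"
  shows "(\<lambda>m. JUST_weight k q \<alpha> \<beta> \<gamma> (m + 2) *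
            cmod (taylor_coeff (JUST_extremal k q \<alpha> \<beta> \<gamma> n) (m + 2))) sums (1 - \<gamma>)"
proof -
  let ?a = "(1 - \<gamma>) / JUST_weight k q \<alpha> \<beta> \<gamma> n"
  have coeff: "cmod (taylor_coeff (JUST_extremal k q \<alpha> \<beta> \<gamma> n) (m + 2))
      = (if m = n - 2 then ?a else 0)" for m
    unfolding JUST_extremal_def[abs_def] taylor_coeff_binomial[OF assms(3)]
    using assms by (simp add: norm_divide flip: of_real_diff of_real_divide)
  have "(\<lambda>m. if m = n - 2 then JUST_weight k q \<alpha> \<beta> \<gamma> (m + 2) * ?a else 0)
      sums (JUST_weight k q \<alpha> \<beta> \<gamma> (n - 2 + 2) * ?a)"
    by (rule sums_single)
  moreover have "JUST_weight k q \<alpha> \<beta> \<gamma> (n - 2 + 2) * ?a = 1 - \<gamma>"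
    using assms by (simp del: add_2_eq_Suc')
  ultimately show ?thesis
    unfolding coeff by (simp add: if_distrib[of "\<lambda>x. _ * x"] cong: if_cong)
qed

theorem theorem2p1:
  fixes k q \<alpha> \<beta> \<gamma> :: real
  assumes "0 \<le> \<gamma>" "\<gamma> < 1" "0 < q" "q < 1" "0 \<le> k" "0 < \<alpha>" "-1 < \<beta>"
  shows "(\<forall>f \<in> class_A.
            summable (\<lambda>n. JUST_weight k q \<alpha> \<beta> \<gamma> (n + 2) * cmod (taylor_coeff f (n + 2))) \<and>
            (\<Sum>n. JUST_weight k q \<alpha> \<beta> \<gamma> (n + 2) * cmod (taylor_coeff f (n + 2))) \<le> 1 - \<gamma>
            \<longrightarrow> f \<in> JUST k q \<alpha> \<beta> \<gamma>) \<and>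
         (\<forall>n \<ge> 2.
            JUST_extremal k q \<alpha> \<beta> \<gamma> n \<in> JUST k q \<alpha> \<beta> \<gamma> \<and>
            (\<lambda>m. JUST_weight k q \<alpha> \<beta> \<gamma> (m + 2) *
                  cmod (taylor_coeff (JUST_extremal k q \<alpha> \<beta> \<gamma> n) (m + 2))) sums (1 - \<gamma>))"
proof (intro conjI ballI allI impI)
  fix f assume "f \<in> class_A"
    and "summable (\<lambda>n. JUST_weight k q \<alpha> \<beta> \<gamma> (n + 2) * cmod (taylor_coeff f (n + 2))) \<and>
      (\<Sum>n. JUST_weight k q \<alpha> \<beta> \<gamma> (n + 2) * cmod (taylor_coeff f (n + 2))) \<le> 1 - \<gamma>"
  then show "f \<in> JUST k q \<alpha> \<beta> \<gamma>"
    using assms by (intro coefficient_criterion) auto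
next
  fix n :: nat assume n: "2 \<le> n"
  have "0 < JUST_weight k q \<alpha> \<beta> \<gamma> n"
    using assms n by (intro JUST_weight_pos) auto
  then show sums: "(\<lambda>m. JUST_weight k q \<alpha> \<beta> \<gamma> (m + 2) *
      cmod (taylor_coeff (JUST_extremal k q \<alpha> \<beta> \<gamma> n) (m + 2))) sums (1 - \<gamma>)"
    using assms n by (intro JUST_extremal_weighted_sum)
  have "JUST_extremal k q \<alpha> \<beta> \<gamma> n \<in> class_A"
    unfolding JUST_extremal_def[abs_def] using n by (rule binomial_in_class_A)
  then show "JUST_extremal k q \<alpha> \<beta> \<gamma> n \<in> JUST k q \<alpha> \<beta> \<gamma>"
    using assms sums_summable[OF sums] sums_unique[OF sums]
    by (intro coefficient_criterion) auto
qed

end
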